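(* Let $\Omega\subset\mathbb{R}^n$ be a bounded domain of class $C^2$. Let $F:\Omega\times\mathbb{R}^n\times\mathbb{S}^n\to\mathbb{R}$ satisfy: (i) $F\in C(\Omega\times\mathbb{R}^n\times\mathbb{S}^n)$; (ii) $F(x,p,X)\le F(x,p,Y)$ for all $x\in\Omega$, $p\in\mathbb{R}^n$ and $X,Y\in\mathbb{S}^n$ with $X\ge Y$; (iii) for any modulus of continuity $\omega$, $$\sup\{|F(x,p,X)|:\ x\in\Omega,\ d(x)\le\delta,\ |p|\le\omega(\delta)/\delta,\ |X|\le\omega(\delta)/\delta^2\}\to0\quad\text{as }\delta\to0;$$ (iv) $\sup_{x\in\Omega}|F(x,p,X)|\to0$ as $|p|,|X|\to0$; (v) for any $M>0$ there exist $a_F,L>0$, $\alpha\in(0,1]$ and $\beta\in(0,1)$, possibly depending on $M$, such that $$F(y,q,Y)-F(x,p,X)\le\beta a_F|x-y|^\alpha+L\delta$$ holds for any $\delta>0$, $x,y\in\Omega$ with $x\ne y$, $p,q\in\mathbb{R}^n$ and $X,Y\in\mathbb{S}^n$ provided that $$F(x,p,X)\le M,\qquad F(y,q,Y)\ge-M,$$ $$|p-\alpha a_F|x-y|^{\alpha-2}(x-y)|\le\delta\,d(x)^{-1},\qquad |q-\alpha a_F|x-y|^{\alpha-2}(x-y)|\le\delta\,d(y)^{-1},$$ and $$\begin{pmatrix}X&0\\0&-Y\end{pmatrix}\le\begin{pmatrix}A&-A\\-A&A\end{pmatrix}+\delta\begin{pmatrix}d(x)^{-2}I_n&0\\0&d(y)^{-2}I_n\end{pmatrix}+\delta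 I_{2n}$$ hold with some $A=A(x,y)\in\mathbb{S}^n$ satisfying $A\le\alpha a_F|x-y|^{\alpha-2}I_n$. If $u\in C(\Omega)$ is a bounded viscosity solution of $$u+F(x,\nabla u,\nabla^2u)=0\quad\text{in }\Omega,$$ then $u\equiv0$ in $\Omega$.
   Context: $\mathbb{S}^n$ is the set of all real symmetric $n\times n$ matrices with the usual partial order; $I_k$ is the $k\times k$ identity matrix; $d(x)$ denotes the distance from $x\in\overline{\Omega}$ to $\partial\Omega$. A modulus of continuity is a nonnegative increasing function $\omega\in C([0,\infty))$ with $\omega(0)=0$. Viscosity solutions. A locally bounded upper (resp. lower) semicontinuous function $u$ in $\Omega$ is a viscosity subsolution (resp. supersolution) of $u+F(x,\nabla u,\nabla^2u)=0$ in $\Omega$ if whenever $x_0\in\Omega$ and $\varphi\in C^2(\Omega)$ are such that $u-\varphi$ attains a local maximum (resp. minimum) at $x_0$, one has $u(x_0)+F(x_0,\nabla\varphi(x_0),\nabla^2\varphi(x_0))\le0$ (resp. $\ge0$). A function $u\in C(\Omega)$ is a viscosity solution if it is both a viscosity subsolution and a viscosity supersolution. *)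

theory Defs
  imports "HOL-Analysis.Analysis"
begin

definition sym_matrices :: "(real^'m^'m) set" where
  "sym_matrices = {X. transpose X = X}"

text \<open>The partial order on symmetric matrices: \<open>Y - X\<close> is positive semidefinite. It is only
  meaningful on \<^const>\<open>sym_matrices\<close>; symmetry is not built in.\<close>

definition loewner_le :: "real^'m^'m \<Rightarrow> real^'m^'m \<Rightarrow> bool"  (infix "\<preceq>" 50) where
  "X \<preceq> Y \<longleftrightarrow> (\<forall>\<xi>. 0 \<le> \<xi> \<bullet> ((Y - X) *v \<xi>))"

text \<open>The block matrix with rows \<open>(A B)\<close> and \<open>(C D)\<close>; the index type \<open>'n + 'n\<close> has \<open>2n\<close> elements.\<close>

definition block_matrix ::
    "real^'n^'n \<Rightarrow> real^'n^'n \<Rightarrow> real^'n^'n \<Rightarrow> real^'n^'n \<Rightarrow> real^('n + 'n)^('n + 'n)" where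
  "block_matrix A B C D =
     (\<chi> i j. case i of
        Inl k \<Rightarrow> (case j of Inl l \<Rightarrow> A $ k $ l | Inr l \<Rightarrow> B $ k $ l)
      | Inr k \<Rightarrow> (case j of Inl l \<Rightarrow> C $ k $ l | Inr l \<Rightarrow> D $ k $ l))"

definition bdist :: "(real^'n) set \<Rightarrow> real^'n \<Rightarrow> real" where
  "bdist \<Omega> x = infdist x (frontier \<Omega>)"

definition modulus_of_continuity :: "(real \<Rightarrow> real) \<Rightarrow> bool" where
  "modulus_of_continuity \<omega> \<longleftrightarrow>
     continuous_on {0..} \<omega> \<and> mono_on {0..} \<omega> \<and> (\<forall>t\<ge>0. 0 \<le> \<omega> t) \<and> \<omega> 0 = 0"

text \<open>\<open>\<phi>\<close> is of class \<open>C\<^sup>2\<close> on the open set \<open>S\<close>, with gradient \<open>D\<phi>\<close> and Hessian matrix \<open>D2\<phi>\<close>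
  (both are uniquely determined on \<open>S\<close>).\<close>

definition C2_on ::
    "(real^'n) set \<Rightarrow> (real^'n \<Rightarrow> real) \<Rightarrow> (real^'n \<Rightarrow> real^'n) \<Rightarrow> (real^'n \<Rightarrow> real^'n^'n) \<Rightarrow> bool" where
  "C2_on S \<phi> D\<phi> D2\<phi> \<longleftrightarrow>
     (\<forall>x\<in>S. GDERIV \<phi> x :> D\<phi> x) \<and>
     (\<forall>x\<in>S. (D\<phi> has_derivative (\<lambda>h. D2\<phi> x *v h)) (at x)) \<and>
     continuous_on S D2\<phi>"

text \<open>A domain is a nonempty connected open set. It is of class \<open>C\<^sup>2\<close> if near every boundary point
  it is, in suitable orthonormal coordinates, the part of a ball lying above the graph of a
  \<open>C\<^sup>2\<close> function of \<open>n - 1\<close> variables. Here the unit vector \<open>e\<close> is the direction of the last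
  coordinate axis, and \<open>\<gamma>\<close> is evaluated at the projection \<open>x - (x \<bullet> e) e\<close> onto the hyperplane
  orthogonal to \<open>e\<close>, so that only the restriction of \<open>\<gamma>\<close> to this hyperplane matters.\<close>

definition C2_domain :: "(real^'n) set \<Rightarrow> bool" where
  "C2_domain \<Omega> \<longleftrightarrow>
     open \<Omega> \<and> connected \<Omega> \<and> \<Omega> \<noteq> {} \<and>
     (\<forall>z\<in>frontier \<Omega>. \<exists>r>0. \<exists>e \<gamma> D\<gamma> D2\<gamma>.
        norm e = 1 \<and> C2_on UNIV \<gamma> D\<gamma> D2\<gamma> \<and>
        \<Omega> \<inter> ball z r = {x \<in> ball z r. \<gamma> (x - (x \<bullet> e) *\<^sub>R e) < x \<bullet> e})"

definition usc_on :: "'a::topological_space set \<Rightarrow> ('a \<Rightarrow> real) \<Rightarrow> bool" where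
  "usc_on S u \<longleftrightarrow> (\<forall>x\<in>S. \<forall>a. u x < a \<longrightarrow> (\<forall>\<^sub>F y in at x within S. u y < a))"

definition lsc_on :: "'a::topological_space set \<Rightarrow> ('a \<Rightarrow> real) \<Rightarrow> bool" where
  "lsc_on S u \<longleftrightarrow> (\<forall>x\<in>S. \<forall>a. a < u x \<longrightarrow> (\<forall>\<^sub>F y in at x within S. a < u y))"

definition locally_bounded_on :: "'a::metric_space set \<Rightarrow> ('a \<Rightarrow> real) \<Rightarrow> bool" where
  "locally_bounded_on S u \<longleftrightarrow> (\<forall>x\<in>S. \<exists>r>0. bounded (u ` (S \<inter> ball x r)))"

text \<open>Viscosity sub-/supersolutions and solutions of \<open>u + F(x, \<nabla>u, \<nabla>\<^sup>2u) = 0\<close> in \<open>\<Omega>\<close>.\<close>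

definition viscosity_subsolution ::
    "(real^'n) set \<Rightarrow> (real^'n \<Rightarrow> real^'n \<Rightarrow> real^'n^'n \<Rightarrow> real) \<Rightarrow> (real^'n \<Rightarrow> real) \<Rightarrow> bool" where
  "viscosity_subsolution \<Omega> F u \<longleftrightarrow>
     locally_bounded_on \<Omega> u \<and> usc_on \<Omega> u \<and>
     (\<forall>x0\<in>\<Omega>. \<forall>\<phi> D\<phi> D2\<phi>. C2_on \<Omega> \<phi> D\<phi> D2\<phi> \<longrightarrow>
        (\<forall>\<^sub>F x in at x0 within \<Omega>. u x - \<phi> x \<le> u x0 - \<phi> x0) \<longrightarrow>
        u x0 + F x0 (D\<phi> x0) (D2\<phi> x0) \<le> 0)"

definition viscosity_supersolution ::
    "(real^'n) set \<Rightarrow> (real^'n \<Rightarrow> real^'n \<Rightarrow> real^'n^'n \<Rightarrow> real) \<Rightarrow> (real^'n \<Rightarrow> real) \<Rightarrow> bool" where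
  "viscosity_supersolution \<Omega> F u \<longleftrightarrow>
     locally_bounded_on \<Omega> u \<and> lsc_on \<Omega> u \<and>
     (\<forall>x0\<in>\<Omega>. \<forall>\<phi> D\<phi> D2\<phi>. C2_on \<Omega> \<phi> D\<phi> D2\<phi> \<longrightarrow>
        (\<forall>\<^sub>F x in at x0 within \<Omega>. u x0 - \<phi> x0 \<le> u x - \<phi> x) \<longrightarrow>
        0 \<le> u x0 + F x0 (D\<phi> x0) (D2\<phi> x0))"

definition viscosity_solution ::
    "(real^'n) set \<Rightarrow> (real^'n \<Rightarrow> real^'n \<Rightarrow> real^'n^'n \<Rightarrow> real) \<Rightarrow> (real^'n \<Rightarrow> real) \<Rightarrow> bool" where
  "viscosity_solution \<Omega> F u \<longleftrightarrow>
     continuous_on \<Omega> u \<and> viscosity_subsolution \<Omega> F u \<and> viscosity_supersolution \<Omega> F u"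

end

theory Submission
  imports Defs "HOL-Real_Asymp.Real_Asymp"
begin

text \<open>Let \<open>d\<close> be the distance to the boundary and let \<open>\<omega>\<close> be the modulus
  \<open>1 / (1 + ln (1 + 1/t))\<close>. It decays so slowly that \<open>\<psi> = - ln \<omega>\<close>, which
  blows up at \<open>0\<close>, still satisfies \<open>\<psi> (t/2) - \<psi> t < \<omega> t\<close>. For small \<open>\<epsilon>\<close> maximize
  \<open>u x - \<epsilon> (\<psi> (d c) + 4 \<omega> (d c) |x - c|\<^sup>2 / (d c)\<^sup>2)\<close> over all pairs with \<open>|x - c| \<le> d c / 2\<close>.
  The blow-up of \<open>\<psi>\<close> gives a maximum, and comparison with the pair \<open>(x, x)\<close> shows that it
  satisfies \<open>|x - c| < d c / 2\<close>. Hence, for this \<open>c\<close>, a quadratic polynomial touches \<open>u\<close> from above at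
  \<open>x\<close>, with gradient of order \<open>\<epsilon> \<omega> (d x) / d x\<close> and Hessian of order \<open>\<epsilon> \<omega> (d x) / (d x)\<^sup>2\<close>.
  Conditions (iii) near the boundary and (iv) away from it make \<open>F\<close> small there, so \<open>u \<le> 0\<close> as
  \<open>\<epsilon> \<rightarrow> 0\<close>; the same applies to \<open>-u\<close>.\<close>

section \<open>A slowly decaying modulus of continuity\<close>

definition log_modulus :: "real \<Rightarrow> real" where
  "log_modulus t = (if t \<le> 0 then 0 else 1 / (1 + ln (1 + 1 / t)))"

lemma log_modulus_pos: "0 < t \<Longrightarrow> 0 < log_modulus t"
  by (auto simp: log_modulus_def intro!: divide_pos_pos add_pos_nonneg)

lemma log_modulus_nonneg: "0 \<le> log_modulus t"
  using log_modulus_pos[of t] by (cases "t > 0") (auto simp: log_modulus_def)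

lemma log_modulus_le_1: "log_modulus t \<le> 1"
  by (auto simp: log_modulus_def intro!: divide_le_eq_1_pos[THEN iffD2] add_pos_nonneg)

lemma log_modulus_mono: "s \<le> t \<Longrightarrow> log_modulus s \<le> log_modulus t"
proof (cases "0 < s")
  case True
  assume "s \<le> t"
  with True have "ln (1 + 1 / t) \<le> ln (1 + 1 / s)" "0 \<le> ln (1 + 1 / t)"
    by (auto simp: frac_le add_pos_pos intro!: ln_mono)
  then show ?thesis
    using True \<open>s \<le> t\<close> by (auto simp: log_modulus_def intro!: divide_left_mono mult_pos_pos add_pos_nonneg)
next
  case False
  then show ?thesis
    using log_modulus_nonneg[of t] by (auto simp: log_modulus_def)
qed

lemma log_modulus_tendsto_0: "(log_modulus \<longlongrightarrow> 0) (at_right 0)"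
proof -
  have "((\<lambda>t. 1 / (1 + ln (1 + 1 / t))) \<longlongrightarrow> (0::real)) (at_right 0)"
    by real_asymp
  moreover have "\<forall>\<^sub>F t in at_right 0. 1 / (1 + ln (1 + 1 / t)) = log_modulus t"
    by (auto simp: log_modulus_def eventually_at_right_field intro!: exI[of _ 1])
  ultimately show ?thesis
    by (rule Lim_transform_eventually)
qed

lemma continuous_on_log_modulus: "continuous_on {0..} log_modulus"
proof -
  have "continuous (at t within {0..}) log_modulus" if "0 \<le> t" for t
  proof (cases "t = 0")
    case True
    have "at (0::real) within {0..} = at_right 0"
      by (rule at_within_Ici_at_right)
    then show ?thesis
      using log_modulus_tendsto_0 True by (simp add: continuous_within log_modulus_def)
  next
    case False
    with that have "0 < t" by simp
    then have "continuous (at t) (\<lambda>t. 1 / (1 + ln (1 + 1 / t)))"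
      using ln_ge_zero[of "1 + 1 / t"]
      by (intro continuous_intros) (auto simp: add_pos_pos add_nonneg_eq_0_iff pos_add_strict)
    moreover have "\<forall>\<^sub>F s in nhds t. 1 / (1 + ln (1 + 1 / s)) = log_modulus s"
      using eventually_nhds_in_open[of "{0<..}" t] \<open>0 < t\<close>
      by (auto elim!: eventually_mono simp: log_modulus_def)
    ultimately have "continuous (at t) log_modulus"
      by (simp add: isCont_cong)
    then show ?thesis
      using continuous_at_imp_continuous_at_within by blast
  qed
  then show ?thesis
    by (simp add: continuous_on_eq_continuous_within)
qed

text \<open>This is the family to which the boundary condition on \<open>F\<close> is applied. The
  argument is doubled because a touching quadratic has its scale set at its centre \<open>c\<close>,
  and \<open>d c \<le> 2 * d x\<close> at the touching point.\<close>

lemma modulus_of_continuity_log_modulus: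
  assumes "0 \<le> C"
  shows "modulus_of_continuity (\<lambda>t. C * log_modulus (2 * t))"
  unfolding modulus_of_continuity_def
proof (intro conjI)
  show "continuous_on {0..} (\<lambda>t. C * log_modulus (2 * t))"
    by (intro continuous_intros continuous_on_compose2[OF continuous_on_log_modulus]) auto
  show "mono_on {0..} (\<lambda>t. C * log_modulus (2 * t))"
    using assms by (auto intro!: mono_onI mult_left_mono log_modulus_mono)
qed (use assms in \<open>auto simp: log_modulus_nonneg\<close>, simp add: log_modulus_def)

text \<open>Halving \<open>t\<close> increases \<open>l = 1 / log_modulus t\<close> by at most ln 2,
  so ln l increases by at most ln (1 + ln 2 / l) \<le> ln 2 / l. Since ln 2 < 1, this is strictly
  below 1 / l, and the strictness is what later keeps the maximum off the constraint
  boundary.\<close>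

lemma ln_log_modulus_half:
  assumes "0 < t"
  shows "ln (log_modulus t) - ln (log_modulus (t / 2)) < log_modulus t"
proof -
  define l where "l = 1 + ln (1 + 1 / t)"
  have l: "1 \<le> l" using assms by (simp add: l_def)
  have "1 + ln (1 + 2 / t) \<le> 1 + ln (2 * (1 + 1 / t))"
    using assms by (intro add_left_mono ln_mono) (auto simp: field_simps intro!: add_pos_pos)
  also have "\<dots> = l + ln 2"
    using assms by (subst ln_mult_pos) (auto simp: l_def intro!: add_pos_pos)
  also have "\<dots> = l * (1 + ln 2 / l)"
    using l by (simp add: field_simps)
  finally have "ln (1 + ln (1 + 2 / t)) \<le> ln (l * (1 + ln 2 / l))"
    using assms by (intro ln_mono) (auto intro!: add_pos_nonneg)
  also have "\<dots> = ln l + ln (1 + ln 2 / l)"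
    using l by (subst ln_mult_pos) (auto intro!: add_pos_nonneg)
  also have "ln (1 + ln 2 / l) \<le> ln 2 / l"
    using l by (intro ln_add_one_self_le_self) auto
  also have "ln 2 / l < 1 / l"
    using l ln_2_less_1 by (simp add: divide_strict_right_mono)
  finally have "ln (1 + ln (1 + 2 / t)) < ln l + 1 / l" by simp
  moreover have "0 < 1 + ln (1 + 2 / t)"
    using assms by (intro add_pos_nonneg) auto
  ultimately show ?thesis
    using assms l by (simp add: log_modulus_def ln_div flip: l_def)
qed

section \<open>Distance to the boundary\<close>

lemma frontier_nonempty_if_bounded:
  fixes \<Omega> :: "'a::euclidean_space set"
  assumes "bounded \<Omega>" "\<Omega> \<noteq> {}"
  shows "frontier \<Omega> \<noteq> {}"
  using assms frontier_eq_empty not_bounded_UNIV by blast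

lemma bdist_pos:
  fixes \<Omega> :: "(real^'n) set"
  assumes "bounded \<Omega>" "open \<Omega>" "x \<in> \<Omega>"
  shows "0 < bdist \<Omega> x"
  unfolding bdist_def
proof (rule infdist_pos_not_in_closed)
  \<comment> \<open>\<open>infdist\<close> to the empty set is 0 by convention, so this case has to
    be excluded.\<close>
  show "frontier \<Omega> \<noteq> {}"
    using assms by (intro frontier_nonempty_if_bounded) auto
qed (use assms in \<open>auto simp: frontier_def interior_open\<close>)

text \<open>A ball is connected, so if it met both \<open>\<Omega>\<close> and its complement it
  would contain a frontier point, at distance less than \<open>bdist \<Omega> x\<close> from
  \<open>x\<close>.\<close>

lemma ball_bdist_subset:
  fixes \<Omega> :: "(real^'n) set"
  assumes "x \<in> \<Omega>"
  shows "ball x (bdist \<Omega> x) \<subseteq> \<Omega>"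
proof (rule ccontr)
  assume *: "\<not> ?thesis"
  then have "0 < bdist \<Omega> x"
    by (metis ball_eq_empty empty_subsetI linorder_not_less)
  with assms have "x \<in> ball x (bdist \<Omega> x) \<inter> \<Omega>" by simp
  with * obtain z where "z \<in> ball x (bdist \<Omega> x)" "z \<in> frontier \<Omega>"
    using connected_Int_frontier[of "ball x (bdist \<Omega> x)" \<Omega>] connected_ball by blast
  then show False
    using infdist_le[of z "frontier \<Omega>" x] by (simp add: bdist_def)
qed

lemma bdist_le_add: "bdist \<Omega> x \<le> bdist \<Omega> y + norm (x - y)"
  unfolding bdist_def using infdist_triangle[of x _ y] by (simp add: dist_norm)

lemma continuous_on_bdist: "continuous_on S (bdist \<Omega>)"
  unfolding bdist_def by (intro continuous_intros)

lemma norm_mat_1_pos: "0 < norm (mat 1 :: real^'n^'n)"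
  by (simp add: vec_eq_iff mat_def)

section \<open>Touching quadratics with controlled gradient and Hessian\<close>

text \<open>The bounds on \<open>2 * k * norm (x0 - c)\<close> and \<open>2 * k\<close> control the
  gradient and Hessian of the quadratic. The last conclusion transfers information from the touching
  point to \<open>x1\<close>; its error vanishes as \<open>\<epsilon>\<close> tends to 0 with
  \<open>x1\<close> fixed.\<close>

lemma touching_quadratic:
  fixes \<Omega> :: "(real^'n) set" and v :: "real^'n \<Rightarrow> real"
  assumes \<Omega>: "bounded \<Omega>" "open \<Omega>"
    and v: "continuous_on \<Omega> v" "bounded (v ` \<Omega>)"
    and x1: "x1 \<in> \<Omega>" and \<epsilon>: "0 < \<epsilon>"
  obtains x0 c k where "x0 \<in> \<Omega>" "0 < k"
    and "2 * k * norm (x0 - c) \<le> 6 * \<epsilon> * log_modulus (2 * bdist \<Omega> x0) / bdist \<Omega> x0"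
    and "2 * k \<le> 18 * \<epsilon> * log_modulus (2 * bdist \<Omega> x0) / (bdist \<Omega> x0)\<^sup>2"
    and "\<forall>\<^sub>F x in at x0 within \<Omega>. v x - k * (norm (x - c))\<^sup>2 \<le> v x0 - k * (norm (x0 - c))\<^sup>2"
    and "v x1 \<le> v x0 - \<epsilon> * ln (log_modulus (bdist \<Omega> x1))"
proof -
  define d where "d = bdist \<Omega>"
  define \<psi> where "\<psi> t = - ln (log_modulus t)" for t
  \<comment> \<open>The factor 4 makes the quadratic penalty equal to
    \<open>\<epsilon> * log_modulus t\<close> when \<open>norm (x - c) = t / 2\<close>.\<close>
  define k where "k t = 4 * \<epsilon> * log_modulus t / t\<^sup>2" for t
  \<comment> \<open>The weights depend on \<open>c\<close> only, so for fixed \<open>c\<close> the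
    penalty is a quadratic polynomial in \<open>x\<close>, smooth even where \<open>d\<close> is
    not.\<close>
  define G where "G x c = v x - \<epsilon> * \<psi> (d c) - k (d c) * (norm (x - c))\<^sup>2" for x c
  obtain M where M: "\<And>x. x \<in> \<Omega> \<Longrightarrow> \<bar>v x\<bar> \<le> M"
    using v(2) by (auto simp: bounded_iff)
  have d_pos: "0 < d x" if "x \<in> \<Omega>" for x
    using bdist_pos[OF \<Omega> that] by (simp add: d_def)
  have k_pos: "0 < k t" if "0 < t" for t
    using that \<epsilon> by (simp add: k_def log_modulus_pos)
  have \<psi>_antimono: "\<psi> t \<le> \<psi> s" if "0 < s" "s \<le> t" for s t
    using that log_modulus_mono[of s t] log_modulus_pos[of s] by (simp add: \<psi>_def)
  have \<psi>_nonneg: "0 \<le> \<psi> t" if "0 < t" for t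
    using log_modulus_pos[OF that] log_modulus_le_1[of t] by (simp add: \<psi>_def)
  \<comment> \<open>The threshold is chosen so that \<open>G x x < G x1 x1\<close> whenever
    \<open>d x < s0\<close>: there \<open>\<epsilon> * \<psi> (d x)\<close> exceeds
    \<open>M - G x1 x1\<close>.\<close>
  have "\<forall>\<^sub>F t in at_right 0. log_modulus t < exp (- ((M - G x1 x1) / \<epsilon>))"
    by (intro order_tendstoD(2)[OF log_modulus_tendsto_0]) auto
  then obtain s0 where s0: "0 < s0" "\<And>t. 0 < t \<Longrightarrow> t < s0 \<Longrightarrow> log_modulus t < exp (- ((M - G x1 x1) / \<epsilon>))"
    by (auto simp: eventually_at_right_field)
  define s where "s = min (s0 / 2) (d x1)"
  have s: "0 < s" "s < s0" "s \<le> d x1"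
    using s0 d_pos[OF x1] by (auto simp: s_def)
  have \<psi>_big: "(M - G x1 x1) / \<epsilon> < \<psi> t" if "0 < t" "t < s0" for t
  proof -
    have "ln (log_modulus t) < ln (exp (- ((M - G x1 x1) / \<epsilon>)))"
      using s0(2)[OF that] log_modulus_pos[OF that(1)] by (subst ln_less_cancel_iff) auto
    then show ?thesis by (simp add: \<psi>_def)
  qed
  \<comment> \<open>\<open>d\<close> is positive outside the closure as well, so \<open>c\<close>
    must be confined explicitly. Using the closure keeps \<open>S\<close> closed, while
    \<open>s \<le> d c\<close> excludes the frontier and puts both points inside
    \<open>\<Omega>\<close>.\<close>
  define S where "S = {(x, c). c \<in> closure \<Omega> \<and> s \<le> d c \<and> norm (x - c) \<le> d c / 2}"
  have S\<Omega>: "c \<in> \<Omega>" "x \<in> \<Omega>" if "(x, c) \<in> S" for x c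
  proof -
    have "c \<notin> frontier \<Omega>" using that s by (auto simp: S_def d_def bdist_def)
    then show c: "c \<in> \<Omega>" using that \<Omega> by (auto simp: S_def frontier_def interior_open)
    show "x \<in> \<Omega>"
      using ball_bdist_subset[OF c] that s by (auto simp: S_def d_def dist_norm norm_minus_commute)
  qed
  have cont_d: "continuous_on A (\<lambda>z. d (f z))" if "continuous_on A f" for A :: "((real^'n) \<times> (real^'n)) set" and f
    using continuous_on_compose2[OF continuous_on_bdist[of UNIV] that] by (simp add: d_def)
  have "closed S"
    unfolding S_def case_prod_unfold
    by (intro closed_Collect_conj closed_Collect_le continuous_intros cont_d closed_vimage_snd[unfolded vimage_def]) auto
  moreover have "bounded S"
  proof (rule bounded_subset)
    show "bounded (\<Omega> \<times> \<Omega>)" using \<Omega> by (intro bounded_Times)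
  qed (use S\<Omega> in auto)
  ultimately have "compact S" by (simp add: compact_eq_bounded_closed)
  moreover have x1S: "(x1, x1) \<in> S"
    using x1 s d_pos[OF x1] closure_subset[of \<Omega>] by (auto simp: S_def)
  moreover have "continuous_on S (\<lambda>z. G (fst z) (snd z))"
  proof -
    have dpos: "0 < d (snd z)" if "z \<in> S" for z using that S\<Omega> d_pos by (cases z) auto
    have "continuous_on S (\<lambda>z. log_modulus (d (snd z)))"
      by (intro continuous_on_compose2[OF continuous_on_log_modulus] cont_d continuous_intros)
         (use dpos in \<open>auto simp: less_imp_le\<close>)
    moreover have "continuous_on S (\<lambda>z. v (fst z))"
      by (intro continuous_on_compose2[OF v(1)] continuous_intros) (use S\<Omega> in auto)
    moreover have "log_modulus (d (snd z)) \<noteq> 0" "d (snd z) \<noteq> 0" if "z \<in> S" for z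
      using log_modulus_pos[OF dpos[OF that]] dpos[OF that] by auto
    ultimately show ?thesis
      unfolding G_def \<psi>_def k_def
      by (intro continuous_intros cont_d) auto
  qed
  ultimately obtain z where "z \<in> S" "\<forall>y\<in>S. G (fst y) (snd y) \<le> G (fst z) (snd z)"
    using continuous_attains_sup[of S "\<lambda>z. G (fst z) (snd z)"] by blast
  then obtain x0 c where S0: "(x0, c) \<in> S" and max: "\<And>x y. (x, y) \<in> S \<Longrightarrow> G x y \<le> G x0 c"
    by (metis fst_conv snd_conv surj_pair)
  define t where "t = d c"
  have x0: "x0 \<in> \<Omega>" and c: "c \<in> \<Omega>" using S\<Omega>[OF S0] by auto
  have t: "0 < t" "norm (x0 - c) \<le> t / 2" using d_pos[OF c] S0 by (auto simp: t_def S_def)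
  have dx0: "t \<le> 2 * d x0" "2 * d x0 \<le> 3 * t"
    using bdist_le_add[of \<Omega> x0 c] bdist_le_add[of \<Omega> c x0] t by (auto simp: t_def d_def norm_minus_commute)
  \<comment> \<open>The diagonal pair may violate \<open>s \<le> d x0\<close> and so lie outside
    \<open>S\<close>; in that case the blow-up of \<open>\<psi>\<close> gives the comparison through
    \<open>(x1, x1)\<close>.\<close>
  have diag: "G x0 x0 \<le> G x0 c"
  proof (cases "s \<le> d x0")
    case True
    then have "(x0, x0) \<in> S"
      using x0 d_pos[OF x0] closure_subset[of \<Omega>] by (auto simp: S_def)
    then show ?thesis by (rule max)
  next
    case False
    then have "M - G x1 x1 < \<epsilon> * \<psi> (d x0)"
      using \<psi>_big[of "d x0"] s d_pos[OF x0] \<epsilon> by (simp add: divide_less_eq mult.commute)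
    then have "G x0 x0 \<le> G x1 x1" using M[OF x0] by (simp add: G_def)
    also have "\<dots> \<le> G x0 c" using x1S by (rule max)
    finally show ?thesis .
  qed
  \<comment> \<open>At equality, moving the centre to \<open>x0\<close> would save
    \<open>\<epsilon> * log_modulus t\<close> of quadratic penalty. Since
    \<open>d x0 \<ge> t / 2\<close>, the increase of \<open>\<psi>\<close> costs strictly less,
    contradicting \<open>diag\<close>.\<close>
  have strict: "norm (x0 - c) < t / 2"
  proof (rule ccontr)
    assume "\<not> ?thesis"
    then have eq: "norm (x0 - c) = t / 2" using t by simp
    have "k t * (norm (x0 - c))\<^sup>2 = \<epsilon> * log_modulus t"
      unfolding eq using t by (simp add: k_def power2_eq_square)
    with diag have "\<epsilon> * (\<psi> t + log_modulus t) \<le> \<epsilon> * \<psi> (d x0)"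
      by (simp add: G_def t_def algebra_simps)
    then have "\<psi> t + log_modulus t \<le> \<psi> (d x0)" using \<epsilon> by simp
    also have "\<dots> \<le> \<psi> (t / 2)" using dx0 t by (intro \<psi>_antimono) auto
    finally show False using ln_log_modulus_half[OF t(1)] by (simp add: \<psi>_def)
  qed
  have w: "log_modulus t \<le> log_modulus (2 * d x0)" using dx0 by (intro log_modulus_mono)
  have d0: "0 < d x0" using d_pos[OF x0] .
  show thesis
  proof (rule that[OF x0 k_pos[OF t(1)]])
    have "2 * k t * norm (x0 - c) \<le> 2 * k t * (t / 2)"
      using t k_pos[OF t(1)] by (intro mult_left_mono) auto
    also have "\<dots> = 4 * \<epsilon> * log_modulus t / t"
      using t by (simp add: k_def power2_eq_square)
    \<comment> \<open>Passing from \<open>t\<close> to \<open>d x0\<close> uses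
      \<open>t \<ge> 2 * d x0 / 3\<close>, so 4 becomes 4 * 3/2 = 6; in the Hessian bound 8 becomes
      8 * 9/4 = 18.\<close>
    also have "\<dots> \<le> 4 * \<epsilon> * log_modulus (2 * d x0) / (2 * d x0 / 3)"
      using t dx0 d0 w \<epsilon> log_modulus_nonneg by (intro frac_le mult_left_mono mult_nonneg_nonneg) auto
    finally show "2 * k t * norm (x0 - c) \<le> 6 * \<epsilon> * log_modulus (2 * bdist \<Omega> x0) / bdist \<Omega> x0"
      by (simp add: d_def)
    have "2 * k t = 8 * \<epsilon> * log_modulus t / t\<^sup>2" by (simp add: k_def)
    also have "\<dots> \<le> 8 * \<epsilon> * log_modulus (2 * d x0) / (2 * d x0 / 3)\<^sup>2"
      using t dx0 d0 w \<epsilon> log_modulus_nonneg by (intro frac_le mult_left_mono mult_nonneg_nonneg power_mono) auto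
    finally show "2 * k t \<le> 18 * \<epsilon> * log_modulus (2 * bdist \<Omega> x0) / (bdist \<Omega> x0)\<^sup>2"
      by (simp add: d_def power2_eq_square)
    \<comment> \<open>By strictness, \<open>(x, c)\<close> stays in \<open>S\<close> for
      \<open>x\<close> near \<open>x0\<close> with \<open>c\<close> frozen, so the global maximum
      over pairs becomes a local maximum in \<open>x\<close>.\<close>
    have "\<forall>\<^sub>F x in at x0 within \<Omega>. dist x x0 < t / 2 - norm (x0 - c)"
      unfolding eventually_at using strict by (intro exI[of _ "t / 2 - norm (x0 - c)"]) auto
    then show "\<forall>\<^sub>F x in at x0 within \<Omega>.
        v x - k t * (norm (x - c))\<^sup>2 \<le> v x0 - k t * (norm (x0 - c))\<^sup>2"
    proof eventually_elim
      case (elim x)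
      then have "norm (x - c) \<le> d c / 2"
        using norm_triangle_ineq[of "x - x0" "x0 - c"] by (simp add: dist_norm t_def)
      then have "(x, c) \<in> S" using S0 by (auto simp: S_def)
      from max[OF this] show ?case by (simp add: G_def t_def)
    qed
    have "G x1 x1 \<le> G x0 c" using x1S by (rule max)
    also have "\<dots> \<le> v x0"
    proof -
      have "0 \<le> \<epsilon> * \<psi> t + k t * (norm (x0 - c))\<^sup>2"
        using \<psi>_nonneg[OF t(1)] k_pos[OF t(1)] \<epsilon> by (intro add_nonneg_nonneg mult_nonneg_nonneg) auto
      then show ?thesis by (simp add: G_def t_def)
    qed
    finally show "v x1 \<le> v x0 - \<epsilon> * ln (log_modulus (bdist \<Omega> x1))"
      by (simp add: G_def \<psi>_def d_def)
  qed
qed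

section \<open>Quadratic test functions and smallness of \<open>F\<close>\<close>

lemma C2_on_quadratic:
  fixes c :: "real^'n"
  shows
  "C2_on S (\<lambda>x. k * (norm (x - c))\<^sup>2) (\<lambda>x. (2 * k) *\<^sub>R (x - c)) (\<lambda>x. (2 * k) *\<^sub>R mat 1)"
  unfolding C2_on_def
proof (intro conjI ballI)
  show "GDERIV (\<lambda>x. k * (norm (x - c))\<^sup>2) x :> (2 * k) *\<^sub>R (x - c)" for x :: "real^'n"
    unfolding gderiv_def power2_norm_eq_inner
    by (auto intro!: derivative_eq_intros simp: inner_commute algebra_simps)
  show "((\<lambda>x. (2 * k) *\<^sub>R (x - c)) has_derivative (\<lambda>h. ((2 * k) *\<^sub>R mat 1) *v h)) (at x)" for x :: "real^'n"
    by (auto intro!: derivative_eq_intros simp flip: scaleR_matrix_vector_assoc)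
qed simp

lemma abs_less_if_SUP_ennreal_less:
  fixes f :: "'a \<Rightarrow> real"
  assumes "(SUP x\<in>A. ennreal \<bar>f x\<bar>) < ennreal \<eta>" "x \<in> A"
  shows "\<bar>f x\<bar> < \<eta>"
  using le_less_trans[OF SUP_upper[OF assms(2)] assms(1)] by (simp add: ennreal_less_iff)

text \<open>In a boundary strip, \<open>\<epsilon> \<le> 1\<close> lets \<open>bdry\<close> apply at
  scale \<open>\<delta> = bdist \<Omega> x\<close>. Outside the strip the bounds on \<open>p\<close>
  and \<open>X\<close> are of order \<open>\<epsilon>\<close> uniformly in \<open>x\<close>, so
  \<open>orig\<close> applies. The requirement \<open>X \<noteq> 0\<close> keeps
  \<open>(p, X)\<close> away from the origin, which the punctured limit in \<open>orig\<close>
  leaves out.\<close>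

lemma eventually_F_small:
  fixes \<Omega> :: "(real^'n) set" and F :: "real^'n \<Rightarrow> real^'n \<Rightarrow> real^'n^'n \<Rightarrow> real"
  assumes \<Omega>: "bounded \<Omega>" "open \<Omega>"
    and bdry: "((\<lambda>\<delta>. SUP (x, p, X) \<in> {(x, p, X). x \<in> \<Omega> \<and> X \<in> sym_matrices \<and> bdist \<Omega> x \<le> \<delta> \<and>
             norm p \<le> C * log_modulus (2 * \<delta>) / \<delta> \<and> norm X \<le> C * log_modulus (2 * \<delta>) / \<delta>\<^sup>2}.
           ennreal \<bar>F x p X\<bar>) \<longlongrightarrow> 0) (at_right 0)"
    and orig: "((\<lambda>(p, X). SUP x \<in> \<Omega>. ennreal \<bar>F x p X\<bar>) \<longlongrightarrow> 0)
           (at (0, 0) within (UNIV \<times> sym_matrices))"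
    and \<eta>: "0 < \<eta>" and C: "0 \<le> C"
  shows "\<forall>\<^sub>F \<epsilon> in at_right 0. \<forall>x\<in>\<Omega>. \<forall>p :: real^'n. \<forall>X\<in>sym_matrices. X \<noteq> 0 \<longrightarrow>
           norm p \<le> C * \<epsilon> * log_modulus (2 * bdist \<Omega> x) / bdist \<Omega> x \<longrightarrow>
           norm X \<le> C * \<epsilon> * log_modulus (2 * bdist \<Omega> x) / (bdist \<Omega> x)\<^sup>2 \<longrightarrow> \<bar>F x p X\<bar> < \<eta>"
proof -
  let ?w = "\<lambda>t. C * log_modulus (2 * t)"
  from order_tendstoD(2)[OF bdry, of "ennreal \<eta>"] \<eta>
  obtain \<delta>0 where \<delta>0: "0 < \<delta>0" and near: "\<And>\<delta>. 0 < \<delta> \<Longrightarrow> \<delta> < \<delta>0 \<Longrightarrow>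
      (SUP (x, p, X) \<in> {(x, p, X). x \<in> \<Omega> \<and> X \<in> sym_matrices \<and> bdist \<Omega> x \<le> \<delta> \<and>
          norm p \<le> ?w \<delta> / \<delta> \<and> norm X \<le> ?w \<delta> / \<delta>\<^sup>2}. ennreal \<bar>F x p X\<bar>) < ennreal \<eta>"
    by (auto simp: eventually_at_right_field)
  from order_tendstoD(2)[OF orig, of "ennreal \<eta>"] \<eta>
  obtain \<rho> where \<rho>: "0 < \<rho>" and far: "\<And>p X. X \<in> sym_matrices \<Longrightarrow> X \<noteq> 0 \<Longrightarrow> norm (p, X) < \<rho> \<Longrightarrow>
      (SUP x\<in>\<Omega>. ennreal \<bar>F x p X\<bar>) < ennreal \<eta>"
    by (auto simp: eventually_at dist_norm)
  \<comment> \<open>This sum bounds \<open>norm p + norm X\<close> where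
    \<open>bdist \<Omega> x \<ge> \<delta>0\<close>, because \<open>log_modulus\<close> is at most
    1.\<close>
  have "((\<lambda>\<epsilon>. C * \<epsilon> / \<delta>0 + C * \<epsilon> / \<delta>0\<^sup>2) \<longlongrightarrow> C * 0 / \<delta>0 + C * 0 / \<delta>0\<^sup>2) (at_right 0)"
    using \<delta>0 by (intro tendsto_intros) auto
  then have "\<forall>\<^sub>F \<epsilon> in at_right 0. C * \<epsilon> / \<delta>0 + C * \<epsilon> / \<delta>0\<^sup>2 < \<rho>"
    using \<rho> by (intro order_tendstoD(2)) auto
  moreover have "\<forall>\<^sub>F \<epsilon>::real in at_right 0. 0 < \<epsilon> \<and> \<epsilon> \<le> 1"
    by (auto simp: eventually_at_right_field intro!: exI[of _ 1])
  ultimately show ?thesis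
  proof eventually_elim
    case (elim \<epsilon>)
    show ?case
    proof (intro ballI allI impI)
      fix x p :: "real^'n" and X :: "real^'n^'n"
      let ?d = "bdist \<Omega> x"
      assume x: "x \<in> \<Omega>" and X: "X \<in> sym_matrices" "X \<noteq> 0"
        and bp: "norm p \<le> C * \<epsilon> * log_modulus (2 * ?d) / ?d"
        and bX: "norm X \<le> C * \<epsilon> * log_modulus (2 * ?d) / ?d\<^sup>2"
      have d: "0 < ?d" using bdist_pos[OF \<Omega> x] .
      show "\<bar>F x p X\<bar> < \<eta>"
      proof (cases "?d < \<delta>0")
        case True
        have "C * \<epsilon> * log_modulus (2 * ?d) \<le> ?w ?d"
          using C elim log_modulus_nonneg by (intro mult_right_mono) (auto intro: mult_left_le)
        then have "C * \<epsilon> * log_modulus (2 * ?d) / ?d \<le> ?w ?d / ?d"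
          "C * \<epsilon> * log_modulus (2 * ?d) / ?d\<^sup>2 \<le> ?w ?d / ?d\<^sup>2"
          using d by (auto intro!: divide_right_mono)
        then have "norm p \<le> ?w ?d / ?d" "norm X \<le> ?w ?d / ?d\<^sup>2"
          using bp bX by linarith+
        with x X show ?thesis
          using abs_less_if_SUP_ennreal_less[where f = "\<lambda>(x, p, X). F x p X" and x = "(x, p, X)"] near[OF d True]
          by (auto simp: case_prod_unfold)
      next
        case False
        have "C * \<epsilon> * log_modulus (2 * ?d) \<le> C * \<epsilon>"
          using C elim log_modulus_le_1 by (intro mult_left_le) auto
        then have "C * \<epsilon> * log_modulus (2 * ?d) / ?d \<le> C * \<epsilon> / \<delta>0"
          "C * \<epsilon> * log_modulus (2 * ?d) / ?d\<^sup>2 \<le> C * \<epsilon> / \<delta>0\<^sup>2"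
          using False \<delta>0 C elim by (auto intro!: frac_le power_mono)
        then have "norm (p, X) < \<rho>"
          using norm_Pair_le[of p X] bp bX elim by linarith
        then show ?thesis
          using abs_less_if_SUP_ennreal_less[where f = "\<lambda>x. F x p X"] far[OF X] x by blast
      qed
    qed
  qed
qed

section \<open>Comparison of \<open>u\<close> and \<open>- u\<close> with zero\<close>

theorem theorem1p2:
  fixes \<Omega> :: "(real^'n) set"
    and F :: "real^'n \<Rightarrow> real^'n \<Rightarrow> real^'n^'n \<Rightarrow> real"
    and u :: "real^'n \<Rightarrow> real"
  assumes dom: "bounded \<Omega>" "C2_domain \<Omega>"
    and cont: "continuous_on (\<Omega> \<times> UNIV \<times> sym_matrices) (\<lambda>(x, p, X). F x p X)"
    and elliptic: "\<And>x p X Y. x \<in> \<Omega> \<Longrightarrow> X \<in> sym_matrices \<Longrightarrow> Y \<in> sym_matrices \<Longrightarrow> Y \<preceq> X \<Longrightarrow>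
           F x p X \<le> F x p Y"
    and bdry: "\<And>\<omega>. modulus_of_continuity \<omega> \<Longrightarrow>
           ((\<lambda>\<delta>. SUP (x, p, X) \<in> {(x, p, X). x \<in> \<Omega> \<and> X \<in> sym_matrices \<and> bdist \<Omega> x \<le> \<delta> \<and>
                     norm p \<le> \<omega> \<delta> / \<delta> \<and> norm X \<le> \<omega> \<delta> / \<delta>\<^sup>2}.
                   ennreal \<bar>F x p X\<bar>) \<longlongrightarrow> 0) (at_right 0)"
    and orig: "((\<lambda>(p, X). SUP x \<in> \<Omega>. ennreal \<bar>F x p X\<bar>) \<longlongrightarrow> 0)
           (at (0, 0) within (UNIV \<times> sym_matrices))"
    and struct_cond: "\<And>M::real. M > 0 \<Longrightarrow>
           \<exists>a L \<alpha> \<beta>. a > 0 \<and> L > 0 \<and> 0 < \<alpha> \<and> \<alpha> \<le> 1 \<and> 0 < \<beta> \<and> \<beta> < 1 \<and>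
             (\<forall>\<delta>>0. \<forall>x\<in>\<Omega>. \<forall>y\<in>\<Omega>. \<forall>p q. \<forall>X\<in>sym_matrices. \<forall>Y\<in>sym_matrices.
                x \<noteq> y \<longrightarrow>
                F x p X \<le> M \<longrightarrow>
                F y q Y \<ge> - M \<longrightarrow>
                norm (p - (\<alpha> * a * norm (x - y) powr (\<alpha> - 2)) *\<^sub>R (x - y)) \<le> \<delta> / bdist \<Omega> x \<longrightarrow>
                norm (q - (\<alpha> * a * norm (x - y) powr (\<alpha> - 2)) *\<^sub>R (x - y)) \<le> \<delta> / bdist \<Omega> y \<longrightarrow>
                (\<exists>A\<in>sym_matrices.
                   A \<preceq> (\<alpha> * a * norm (x - y) powr (\<alpha> - 2)) *\<^sub>R mat 1 \<and>
                   block_matrix X 0 0 (- Y) \<preceq>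
                     block_matrix A (- A) (- A) A
                     + \<delta> *\<^sub>R block_matrix ((1 / (bdist \<Omega> x)\<^sup>2) *\<^sub>R mat 1) 0
                                         0 ((1 / (bdist \<Omega> y)\<^sup>2) *\<^sub>R mat 1)
                     + \<delta> *\<^sub>R mat 1) \<longrightarrow>
                F y q Y - F x p X \<le> \<beta> * a * norm (x - y) powr \<alpha> + L * \<delta>)"
    and bdd: "bounded (u ` \<Omega>)"
    and sol: "viscosity_solution \<Omega> F u"
  shows "\<forall>x\<in>\<Omega>. u x = 0"
proof -
  have \<Omega>: "bounded \<Omega>" "open \<Omega>"
    using dom by (auto simp: C2_domain_def)
  define N where "N = norm (mat 1 :: real^'n^'n)"
  \<comment> \<open>One constant for both bounds: 6 serves the gradient, and \<open>18 * N\<close>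
    the Hessian, a multiple of the identity matrix with norm \<open>2 * k * N\<close>.\<close>
  define C where "C = 6 + 18 * N"
  have N: "0 \<le> N" and C: "0 \<le> C" by (auto simp: N_def C_def)
  have u: "continuous_on \<Omega> u" "viscosity_subsolution \<Omega> F u" "viscosity_supersolution \<Omega> F u"
    using sol by (auto simp: viscosity_solution_def)
  \<comment> \<open>One argument covers \<open>v = u\<close> with \<open>\<sigma> = 1\<close> and
    \<open>v = - u\<close> with \<open>\<sigma> = -1\<close>. In the second case the negated
    quadratic touches \<open>u\<close> from below, so \<open>\<sigma>\<close> enters the derivatives
    passed to \<open>F\<close>.\<close>
  have sign: "v x1 \<le> 0"
    if v: "continuous_on \<Omega> v" "bounded (v ` \<Omega>)" and x1: "x1 \<in> \<Omega>" and \<sigma>: "\<bar>\<sigma>\<bar> = 1"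
      and test: "\<And>x0 k c. x0 \<in> \<Omega> \<Longrightarrow>
        \<forall>\<^sub>F x in at x0 within \<Omega>. v x - k * (norm (x - c))\<^sup>2 \<le> v x0 - k * (norm (x0 - c))\<^sup>2 \<Longrightarrow>
        v x0 \<le> \<bar>F x0 ((2 * (\<sigma> * k)) *\<^sub>R (x0 - c)) ((2 * (\<sigma> * k)) *\<^sub>R mat 1)\<bar>"
    for v x1 and \<sigma> :: real
  proof (rule field_le_epsilon)
    fix \<eta> :: real assume \<eta>: "0 < \<eta>"
    let ?l = "ln (log_modulus (bdist \<Omega> x1))"
    \<comment> \<open>At the touching point \<open>v\<close> is bounded by the absolute value of
      \<open>F\<close>, hence by \<open>\<eta>\<close>. Here \<open>x1\<close> and
      \<open>\<eta>\<close> are fixed, so \<open>?l\<close> is a constant and letting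
      \<open>\<epsilon>\<close> tend to 0 removes the last term.\<close>
    have "\<forall>\<^sub>F \<epsilon> in at_right 0. v x1 \<le> \<eta> - \<epsilon> * ?l"
      using eventually_F_small[OF \<Omega> bdry[OF modulus_of_continuity_log_modulus[OF C]] orig \<eta> C] eventually_at_right_less[of 0]
    proof eventually_elim
      case (elim \<epsilon>)
      obtain x0 c k where x0: "x0 \<in> \<Omega>" and k: "0 < k"
        and bp: "2 * k * norm (x0 - c) \<le> 6 * \<epsilon> * log_modulus (2 * bdist \<Omega> x0) / bdist \<Omega> x0"
        and bX: "2 * k \<le> 18 * \<epsilon> * log_modulus (2 * bdist \<Omega> x0) / (bdist \<Omega> x0)\<^sup>2"
        and max: "\<forall>\<^sub>F x in at x0 within \<Omega>. v x - k * (norm (x - c))\<^sup>2 \<le> v x0 - k * (norm (x0 - c))\<^sup>2"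
        and le: "v x1 \<le> v x0 - \<epsilon> * ?l"
        using touching_quadratic[OF \<Omega> v x1 elim(2)] .
      let ?p = "(2 * (\<sigma> * k)) *\<^sub>R (x0 - c)" and ?X = "(2 * (\<sigma> * k)) *\<^sub>R (mat 1 :: real^'n^'n)"
      let ?w = "\<epsilon> * log_modulus (2 * bdist \<Omega> x0)"
      have d: "0 < bdist \<Omega> x0" using bdist_pos[OF \<Omega> x0] .
      have w: "0 \<le> ?w" using elim(2) log_modulus_nonneg by simp
      have norms: "norm ?p = 2 * k * norm (x0 - c)" "norm ?X = 2 * k * N"
        using k \<sigma> by (simp_all add: abs_mult N_def)
      have "2 * k * norm (x0 - c) \<le> C * ?w / bdist \<Omega> x0"
        using order_trans[OF bp, of "C * ?w / bdist \<Omega> x0"] w d N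
        by (simp add: C_def divide_right_mono mult.assoc mult_right_mono)
      moreover have "2 * k * N \<le> C * ?w / (bdist \<Omega> x0)\<^sup>2"
      proof -
        have "2 * k * N \<le> 18 * \<epsilon> * log_modulus (2 * bdist \<Omega> x0) / (bdist \<Omega> x0)\<^sup>2 * N"
          using bX N by (rule mult_right_mono)
        also have "\<dots> = (18 * N) * ?w / (bdist \<Omega> x0)\<^sup>2" by simp
        also have "\<dots> \<le> C * ?w / (bdist \<Omega> x0)\<^sup>2"
          using w by (intro divide_right_mono mult_right_mono) (auto simp: C_def)
        finally show ?thesis .
      qed
      moreover have "?X \<in> sym_matrices"
        by (simp add: sym_matrices_def transpose_scalar)
      moreover have "?X \<noteq> 0" using k \<sigma> norm_mat_1_pos[where 'n='n] by auto
      ultimately have "\<bar>F x0 ?p ?X\<bar> < \<eta>"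
        using elim(1)[rule_format, OF x0, of ?X ?p] unfolding norms by (simp add: mult.assoc)
      then show ?case using test[OF x0 max] le by linarith
    qed
    moreover have "((\<lambda>\<epsilon>. \<eta> - \<epsilon> * ?l) \<longlongrightarrow> \<eta> - 0 * ?l) (at_right 0)"
      by (intro tendsto_intros)
    ultimately show "v x1 \<le> 0 + \<eta>"
      using tendsto_lowerbound[of "\<lambda>\<epsilon>. \<eta> - \<epsilon> * ?l" _ "at_right 0" "v x1"] by simp
  qed
  show ?thesis
  proof
    fix x assume x: "x \<in> \<Omega>"
    have "u x \<le> 0"
    proof (rule sign[OF u(1) bdd x, of 1])
      fix x0 c :: "real^'n" and k :: real
      assume "x0 \<in> \<Omega>" "\<forall>\<^sub>F x in at x0 within \<Omega>. u x - k * (norm (x - c))\<^sup>2 \<le> u x0 - k * (norm (x0 - c))\<^sup>2"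
      then have "u x0 + F x0 ((2 * k) *\<^sub>R (x0 - c)) ((2 * k) *\<^sub>R mat 1) \<le> 0"
        using u(2) C2_on_quadratic[of \<Omega> k c] unfolding viscosity_subsolution_def by blast
      then show "u x0 \<le> \<bar>F x0 ((2 * (1 * k)) *\<^sub>R (x0 - c)) ((2 * (1 * k)) *\<^sub>R mat 1)\<bar>" by simp
    qed simp
    moreover have "- u x \<le> 0"
    proof (rule sign[OF _ _ x, of "\<lambda>x. - u x" "-1"])
      show "continuous_on \<Omega> (\<lambda>x. - u x)" using u(1) by (intro continuous_intros)
      show "bounded ((\<lambda>x. - u x) ` \<Omega>)" using bdd by (auto simp: bounded_iff)
      fix x0 c :: "real^'n" and k :: real
      assume x0: "x0 \<in> \<Omega>" and
        "\<forall>\<^sub>F x in at x0 within \<Omega>. - u x - k * (norm (x - c))\<^sup>2 \<le> - u x0 - k * (norm (x0 - c))\<^sup>2"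
      \<comment> \<open>A local maximum for \<open>- u\<close> is rewritten as a local minimum for
        \<open>u\<close> against the quadratic with coefficient \<open>- k\<close>.\<close>
      then have "\<forall>\<^sub>F x in at x0 within \<Omega>. u x0 - (- k) * (norm (x0 - c))\<^sup>2 \<le> u x - (- k) * (norm (x - c))\<^sup>2"
        by (auto elim!: eventually_mono)
      then have "0 \<le> u x0 + F x0 ((2 * - k) *\<^sub>R (x0 - c)) ((2 * - k) *\<^sub>R mat 1)"
        using u(3) x0 C2_on_quadratic[of \<Omega> "- k" c] unfolding viscosity_supersolution_def by blast
      then show "- u x0 \<le> \<bar>F x0 ((2 * (-1 * k)) *\<^sub>R (x0 - c)) ((2 * (-1 * k)) *\<^sub>R mat 1)\<bar>" by simp
    qed simp
    ultimately show "u x = 0" by simp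
  qed
qed

end
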